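(* Let $G$ be a finite simple connected graph of order $n$. Then: (i) if $n\ge 2$, then $eqdim(G)=n-1$ if and only if $G$ is (isomorphic to) a path of order $2$; (ii) if $n\ge 3$, then $eqdim(G)=n-2$ if and only if $G$ is (isomorphic to) one of $P_3,P_4,P_5,P_6,C_3,C_4,C_5$.
   Context: All graphs are finite, simple, undirected and connected; $d(x,y)$ denotes the graph distance. A set $S\subseteq V(G)$ is a distance-equalizer set of $G$ if for every two distinct vertices $x,y\in V(G)\setminus S$ there is $w\in S$ with $d(x,w)=d(y,w)$. The equidistant dimension $eqdim(G)$ is the minimum cardinality of a distance-equalizer set of $G$. $P_n$ and $C_n$ denote the path and the cycle of order $n$. *)

theory Defs
  imports "Graph_Theory.Graph_Theory"
begin

text \<open>
  A finite simple undirected graph is a finite symmetric loop-free digraph without parallel arcs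
  (locale \<^locale>\<open>graph\<close>), each edge being represented by its two opposite arcs. The graph distance
  is the shortest-path distance for unit arc weights, with values in the extended reals; in a
  connected graph it is always finite.
\<close>

definition graph_dist :: "('a,'b) pre_digraph \<Rightarrow> 'a \<Rightarrow> 'a \<Rightarrow> ereal" where
  "graph_dist G u v = wf_digraph.\<mu> G (\<lambda>_. 1) u v"

definition distance_equalizer :: "('a,'b) pre_digraph \<Rightarrow> 'a set \<Rightarrow> bool" where
  "distance_equalizer G S \<longleftrightarrow> S \<subseteq> verts G \<and>
     (\<forall>x \<in> verts G - S. \<forall>y \<in> verts G - S. x \<noteq> y \<longrightarrow>
        (\<exists>w \<in> S. graph_dist G x w = graph_dist G y w))"

definition eqdim :: "('a,'b) pre_digraph \<Rightarrow> nat" where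
  "eqdim G = (LEAST k. \<exists>S. distance_equalizer G S \<and> card S = k)"

text \<open>The minimum is taken over a nonempty set: the whole vertex set qualifies.\<close>

lemma distance_equalizer_verts: "distance_equalizer G (verts G)"
  by (simp add: distance_equalizer_def)

definition path_graph :: "nat \<Rightarrow> (nat, nat \<times> nat) pre_digraph" where
  "path_graph n = with_proj
     \<lparr> pverts = {..<n},
       parcs = {(i, j). i < n \<and> j < n \<and> (j = i + 1 \<or> i = j + 1)} \<rparr>"

text \<open>The following is the cycle of order \<open>n\<close> only for \<open>n \<ge> 3\<close>.\<close>

definition cycle_graph :: "nat \<Rightarrow> (nat, nat \<times> nat) pre_digraph" where
  "cycle_graph n = with_proj
     \<lparr> pverts = {..<n},
       parcs = {(i, j). i < n \<and> j < n \<and> (j = (i + 1) mod n \<or> i = (j + 1) mod n)} \<rparr>"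

lemma graph_path_graph: "graph (path_graph n)"
proof -
  have "finite {(i, j). i < n \<and> j < n \<and> (j = i + 1 \<or> i = j + 1)}"
    by (rule finite_subset[of _ "{..<n} \<times> {..<n}"]) auto
  then show ?thesis
    unfolding path_graph_def
    by unfold_locales (auto simp: symmetric_def arc_to_ends_def intro!: symI)
qed

lemma graph_cycle_graph:
  assumes "3 \<le> n"
  shows "graph (cycle_graph n)"
proof -
  have "finite {(i, j). i < n \<and> j < n \<and> (j = (i + 1) mod n \<or> i = (j + 1) mod n)}"
    by (rule finite_subset[of _ "{..<n} \<times> {..<n}"]) auto
  moreover have "Suc i mod n \<noteq> i" if "i < n" for i
    using that assms by (cases "Suc i = n") auto
  ultimately show ?thesis
    unfolding cycle_graph_def
    by unfold_locales (auto simp: symmetric_def arc_to_ends_def intro!: symI dest: sym)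
qed

end

theory Submission
  imports Defs
begin

text \<open>
  A set of \<open>k\<close> vertices can be left outside a distance-equalizer set exactly if any two of them
  are at equal distance from some vertex that is not among them (\<open>eqdim_le_iff\<close>). So \<open>eqdim G\<close> is at
  least \<open>n - 2\<close> precisely when no three vertices can be left out together, and at least \<open>n - 1\<close>
  when no two can.

  A vertex with three neighbours forbids this at once: the neighbours are all at distance one from
  it, so they can be left out. Hence large equidistant dimension forces maximum degree at most two,
  and a connected graph of maximum degree at most two is a path or a cycle
  (\<open>path_or_cycle_labelling\<close>): the vertices of a longest path are closed under adjacency, and the
  only possible extra edge joins its two ends.

  It remains to look at paths and cycles with vertices \<open>0, \<dots>, n - 1\<close>. On a path, \<open>x\<close> and \<open>y\<close>
  are equidistant only from their midpoint. Three vertices \<open>x < y < z\<close> can thus be left out only if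
  both gaps are even and \<open>y\<close> is not the midpoint of \<open>x\<close> and \<open>z\<close>; the gaps are then at least \<open>2\<close> and
  \<open>4\<close>, and \<open>0, 2, 6\<close> shows that seven vertices suffice. On a cycle at most two vertices are at a
  given distance from a vertex, so the three equalizing vertices are distinct and \<open>n \<ge> 6\<close>;
  conversely \<open>0, 2, 4\<close> works for \<open>n = 6\<close> and \<open>0, 2, 6\<close> for all larger \<open>n\<close>. Finally, in paths and
  cycles on at least three vertices, \<open>0\<close> and \<open>2\<close> are equalized by \<open>1\<close>, so the dimension is at most
  \<open>n - 2\<close> as soon as \<open>n \<ge> 3\<close>, which leaves only \<open>n = 2\<close> for part (i).
\<close>

text \<open>Otherwise every adjacency \<open>x \<rightarrow> y\<close> could also be read as a function space.\<close>

unbundle no funcset_syntax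

section \<open>Distances\<close>

lemma (in wf_digraph) awalk_cost_unit: "awalk_cost (\<lambda>_. 1) p = real (length p)"
  by (induction p) auto

lemma (in wf_digraph) graph_dist_le_length:
  assumes "awalk x p w"
  shows "graph_dist G x w \<le> ereal (real (length p))"
  using min_cost_le_walk_cost[OF assms, of "\<lambda>_. 1"]
  by (simp add: graph_dist_def awalk_cost_unit)

text \<open>A walk from \<open>x\<close> to \<open>w\<close> has to bring the value of \<open>f\<close> down to \<open>0\<close>, and each arc lowers it by
  at most one.\<close>
lemma (in wf_digraph) graph_dist_ge:
  fixes f :: "'a \<Rightarrow> nat"
  assumes "f w = 0"
    and lipschitz: "\<And>x y. x \<rightarrow> y \<Longrightarrow> f x \<le> f y + 1"
  shows "ereal (real (f x)) \<le> graph_dist G x w"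
proof -
  have "f x \<le> length p" if "awalk x p w" for p
    using that
  proof (induction p arbitrary: x)
    case Nil
    then show ?case using assms(1) by (simp add: awalk_Nil_iff)
  next
    case (Cons e p)
    then have "e \<in> arcs G" "x = tail G e" "awalk (head G e) p w"
      by (auto simp: awalk_Cons_iff)
    moreover from this have "x \<rightarrow> head G e"
      by (auto intro: dominatesI simp: arc_to_ends_def)
    ultimately show ?case
      using Cons.IH[of "head G e"] lipschitz[of x "head G e"] by simp
  qed
  then show ?thesis
    unfolding graph_dist_def \<mu>_def awalk_cost_unit by (intro INF_greatest) auto
qed

text \<open>This characterizes the distance to \<open>w\<close> without mentioning walks: following the descending
  neighbours gives a walk whose length attains the lower bound. It is how the distances in paths
  and cycles are computed.\<close>
lemma (in wf_digraph) graph_dist_eqI: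
  fixes f :: "'a \<Rightarrow> nat"
  assumes "w \<in> verts G" and "f w = 0"
    and "\<And>x y. x \<rightarrow> y \<Longrightarrow> f x \<le> f y + 1"
    and descent: "\<And>x. x \<in> verts G \<Longrightarrow> x \<noteq> w \<Longrightarrow> \<exists>y. x \<rightarrow> y \<and> f x = f y + 1"
    and "x \<in> verts G"
  shows "graph_dist G x w = ereal (real (f x))"
proof (rule antisym)
  have "\<exists>p. awalk x p w \<and> length p = f x"
    using \<open>x \<in> verts G\<close>
  proof (induction "f x" arbitrary: x rule: less_induct)
    case less
    show ?case
    proof (cases "x = w")
      case True
      then show ?thesis using assms(1,2) by (intro exI[of _ "[]"]) (simp add: awalk_Nil_iff)
    next
      case False
      then obtain y where y: "x \<rightarrow> y" "f x = f y + 1"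
        using descent less.prems by blast
      then obtain p where p: "awalk y p w" "length p = f y"
        using less.hyps[of y] adj_in_verts by auto
      obtain e where "e \<in> arcs G" "tail G e = x" "head G e = y"
        using y(1) by blast
      then have "awalk x (e # p) w"
        using p by (auto simp: awalk_Cons_iff)
      then show ?thesis using p y by (metis Suc_eq_plus1 length_Cons)
    qed
  qed
  then show "graph_dist G x w \<le> ereal (real (f x))"
    using graph_dist_le_length by metis
qed (rule graph_dist_ge, fact+)

lemma (in loopfree_digraph) graph_dist_adjacent:
  assumes "x \<rightarrow> w"
  shows "graph_dist G x w = 1"
proof (rule antisym)
  obtain e where "e \<in> arcs G" "tail G e = x" "head G e = w"
    using assms by blast
  then have "awalk x [e] w" by (auto simp: awalk_Cons_iff awalk_Nil_iff)
  from graph_dist_le_length[OF this] show "graph_dist G x w \<le> 1" by (simp add: one_ereal_def)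
  have "x \<noteq> w" using assms adj_not_same by blast
  \<comment> \<open>The indicator of the vertices other than \<open>w\<close> is a valid lower bound.\<close>
  with graph_dist_ge[of "\<lambda>y. if y = w then 0 else 1" w x] show "1 \<le> graph_dist G x w"
    by (simp add: one_ereal_def)
qed

section \<open>Bounding the equidistant dimension\<close>

text \<open>Enlarging the set adds equalizing vertices and removes pairs to be equalized.\<close>
lemma distance_equalizer_mono:
  assumes "distance_equalizer G S" "S \<subseteq> S'" "S' \<subseteq> verts G"
  shows "distance_equalizer G S'"
  using assms unfolding distance_equalizer_def by blast

text \<open>By monotonicity an equalizer set smaller than required can be filled up, so the
  complement \<open>T\<close> can be taken to have exactly \<open>k\<close> elements.\<close>
lemma eqdim_le_iff:
  assumes "finite (verts G)" and "k \<le> card (verts G)"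
  shows "eqdim G \<le> card (verts G) - k \<longleftrightarrow>
    (\<exists>T \<subseteq> verts G. card T = k \<and> distance_equalizer G (verts G - T))"
proof
  assume le: "eqdim G \<le> card (verts G) - k"
  have "\<exists>S. distance_equalizer G S \<and> card S = eqdim G"
    unfolding eqdim_def
    by (rule LeastI_ex[where P = "\<lambda>k. \<exists>S. distance_equalizer G S \<and> card S = k"])
      (use distance_equalizer_verts in blast)
  then obtain S where S: "distance_equalizer G S" "card S = eqdim G" by blast
  then have "S \<subseteq> verts G" by (simp add: distance_equalizer_def)
  with assms(1) have "card (verts G - S) = card (verts G) - card S"
    by (meson card_Diff_subset finite_subset)
  with S le assms(2) have "k \<le> card (verts G - S)" by linarith
  then obtain T where "T \<subseteq> verts G - S" "card T = k"
    by (meson obtain_subset_with_card_n)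
  with S \<open>S \<subseteq> verts G\<close> show "\<exists>T \<subseteq> verts G. card T = k \<and> distance_equalizer G (verts G - T)"
    by (intro exI[of _ T]) (auto elim!: distance_equalizer_mono)
next
  assume "\<exists>T \<subseteq> verts G. card T = k \<and> distance_equalizer G (verts G - T)"
  then obtain T where T: "T \<subseteq> verts G" "card T = k" "distance_equalizer G (verts G - T)"
    by blast
  with assms(1) have "card (verts G - T) = card (verts G) - k"
    by (meson card_Diff_subset finite_subset)
  with T show "eqdim G \<le> card (verts G) - k"
    unfolding eqdim_def by (intro Least_le) blast
qed

text \<open>The common neighbour \<open>x\<close> has distance one to every vertex of \<open>N\<close>, so all of \<open>N\<close> can be left
  out.\<close>
lemma (in digraph) eqdim_le_if_neighbours:
  assumes "\<And>t. t \<in> N \<Longrightarrow> t \<rightarrow> x"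
  shows "eqdim G \<le> card (verts G) - card N"
proof (cases "N = {}")
  case True
  have "\<exists>T \<subseteq> verts G. card T = 0 \<and> distance_equalizer G (verts G - T)"
    by (intro exI[of _ "{}"]) (simp add: distance_equalizer_verts)
  then show ?thesis
    using True eqdim_le_iff[of G 0] by simp
next
  case False
  have N: "N \<subseteq> verts G"
    using assms adj_in_verts by blast
  have x: "x \<in> verts G - N"
    using False assms adj_in_verts adj_not_same by blast
  have "graph_dist G t x = 1" if "t \<in> N" for t
    using that assms graph_dist_adjacent by blast
  with x have "distance_equalizer G (verts G - N)"
    unfolding distance_equalizer_def by (metis Diff_Diff_Int Diff_subset Int_iff)
  with N show ?thesis
    using eqdim_le_iff[OF finite_verts card_mono[OF finite_verts N]] by blast
qed

section \<open>Labelled graphs\<close>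

text \<open>An isomorphism from the graph on \<open>0, \<dots>, n - 1\<close> with adjacency \<open>E\<close>, freed from the choice
  of arc names: in a graph without parallel arcs the vertex map determines the arc map.\<close>
definition labelling :: "('a, 'b) pre_digraph \<Rightarrow> nat \<Rightarrow> (nat \<Rightarrow> nat \<Rightarrow> bool) \<Rightarrow> (nat \<Rightarrow> 'a) \<Rightarrow> bool" where
  "labelling G n E v \<longleftrightarrow> bij_betw v {..<n} (verts G) \<and>
     (\<forall>i<n. \<forall>j<n. v i \<rightarrow>\<^bsub>G\<^esub> v j \<longleftrightarrow> E i j)"

lemma (in nomulti_digraph) digraph_iso_labelled_iff:
  fixes n :: nat and E :: "nat \<Rightarrow> nat \<Rightarrow> bool"
  defines "H \<equiv> with_proj \<lparr>pverts = {..<n}, parcs = {(i, j). i < n \<and> j < n \<and> E i j}\<rparr>"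
  shows "digraph_iso G H \<longleftrightarrow> (\<exists>v. labelling G n E v)"
proof
  assume "digraph_iso G H"
  then obtain f where f: "digraph_isomorphism f" and H: "H = app_iso f G"
    unfolding digraph_iso_def by blast
  let ?g = "iso_verts f"
  have "?g ` verts G = {..<n}"
    using arg_cong[OF H, of verts] by (simp add: H_def)
  moreover have inj: "inj_on ?g (verts G)"
    using f by (simp add: digraph_isomorphism_def)
  ultimately have g: "bij_betw ?g (verts G) {..<n}" by (simp add: bij_betw_def)
  \<comment> \<open>The target stores its arcs as pairs, so the vertex map dictates the image of each arc.\<close>
  have tail: "iso_tail f = fst" and head: "iso_head f = snd"
    using arg_cong[OF H, of tail] arg_cong[OF H, of head] by (simp_all add: H_def)
  have arcs: "iso_arcs f ` arcs G = {(i, j). i < n \<and> j < n \<and> E i j}"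
    using arg_cong[OF H, of arcs] by (simp add: H_def)
  have iso_arc: "iso_arcs f e = (?g (tail G e), ?g (head G e))" if "e \<in> arcs G" for e
    using f that tail head unfolding digraph_isomorphism_def by (metis prod.collapse)
  have adj: "x \<rightarrow> y \<longleftrightarrow> E (?g x) (?g y)" if xy: "x \<in> verts G" "y \<in> verts G" for x y
  proof
    assume "x \<rightarrow> y"
    then obtain e where "e \<in> arcs G" "tail G e = x" "head G e = y" by blast
    with iso_arc arcs show "E (?g x) (?g y)" by (metis (mono_tags, lifting) case_prodD imageI mem_Collect_eq)
  next
    assume "E (?g x) (?g y)"
    moreover have "?g x < n" "?g y < n" using g xy bij_betwE by fastforce+
    ultimately have "(?g x, ?g y) \<in> iso_arcs f ` arcs G" unfolding arcs by simp
    then obtain e where e: "e \<in> arcs G" "iso_arcs f e = (?g x, ?g y)" by force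
    with iso_arc have "?g (tail G e) = ?g x" "?g (head G e) = ?g y" by auto
    with e xy inj have "tail G e = x" "head G e = y" by (auto dest: inj_onD)
    with e(1) show "x \<rightarrow> y" by (auto intro: dominatesI simp: arc_to_ends_def)
  qed
  let ?v = "the_inv_into (verts G) ?g"
  have v: "bij_betw ?v {..<n} (verts G)" by (rule bij_betw_the_inv_into[OF g])
  moreover have "?g (?v i) = i" if "i < n" for i
    using g that by (intro f_the_inv_into_f_bij_betw) auto
  ultimately have "labelling G n E ?v"
    using adj unfolding labelling_def by (simp add: bij_betw_apply)
  then show "\<exists>v. labelling G n E v" by blast
next
  assume "\<exists>v. labelling G n E v"
  then obtain v where "labelling G n E v" ..
  then have v: "bij_betw v {..<n} (verts G)"
    and adj: "\<And>i j. i < n \<Longrightarrow> j < n \<Longrightarrow> v i \<rightarrow> v j \<longleftrightarrow> E i j"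
    by (simp_all add: labelling_def)
  define g where "g = the_inv_into {..<n} v"
  have g: "bij_betw g (verts G) {..<n}"
    unfolding g_def by (rule bij_betw_the_inv_into[OF v])
  have gv: "g (v i) = i" if "i < n" for i
    unfolding g_def using v that by (auto simp: bij_betw_def the_inv_into_f_f)
  have vg: "v (g x) = x" "g x < n" if "x \<in> verts G" for x
    using v g that unfolding g_def
    by (auto simp: f_the_inv_into_f_bij_betw dest: bij_betwE)
  define f where "f = \<lparr>iso_verts = g, iso_arcs = (\<lambda>e. (g (tail G e), g (head G e))),
    iso_head = snd, iso_tail = fst\<rparr>"
  have injg: "inj_on g (verts G)" using g by (simp add: bij_betw_def)
  have "inj_on (iso_arcs f) (arcs G)"
    by (rule inj_onI, rule no_multi_arcs)
      (auto simp: f_def arc_to_ends_def dest: inj_onD[OF injg])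
  with injg have "digraph_isomorphism f"
    unfolding digraph_isomorphism_def using wf_digraph by (simp add: f_def)
  moreover have "iso_arcs f ` arcs G = {(i, j). i < n \<and> j < n \<and> E i j}"
  proof (intro equalityI subsetI)
    fix p assume "p \<in> iso_arcs f ` arcs G"
    then obtain e where e: "e \<in> arcs G" "p = (g (tail G e), g (head G e))"
      by (auto simp: f_def)
    have "tail G e \<rightarrow> head G e"
      using e by (auto intro: dominatesI simp: arc_to_ends_def)
    with e adj[of "g (tail G e)" "g (head G e)"] show "p \<in> {(i, j). i < n \<and> j < n \<and> E i j}"
      by (simp add: vg)
  next
    fix p assume "p \<in> {(i, j). i < n \<and> j < n \<and> E i j}"
    then obtain i j where p: "p = (i, j)" "i < n" "j < n" "v i \<rightarrow> v j"
      using adj by auto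
    then obtain e where "e \<in> arcs G" "tail G e = v i" "head G e = v j" by blast
    with p show "p \<in> iso_arcs f ` arcs G"
      by (intro image_eqI[of _ _ e]) (auto simp: f_def gv)
  qed
  moreover have "g ` verts G = {..<n}" using g by (simp add: bij_betw_def)
  ultimately show "digraph_iso G H"
    unfolding digraph_iso_def
    by (intro exI[of _ f]) (auto simp: H_def app_iso_def with_proj_def f_def)
qed

text \<open>The criterion \<open>graph_dist_eqI\<close>, carried over to labels: \<open>d i k\<close> is recognized as the distance
  by how it changes along an edge.\<close>
lemma (in wf_digraph) labelling_graph_dist:
  fixes d :: "nat \<Rightarrow> nat \<Rightarrow> nat"
  assumes lab: "labelling G n E v"
    and "\<And>i. i < n \<Longrightarrow> d i i = 0"
    and "\<And>i j k. i < n \<Longrightarrow> j < n \<Longrightarrow> k < n \<Longrightarrow> E i j \<Longrightarrow> d i k \<le> d j k + 1"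
    and desc: "\<And>i k. i < n \<Longrightarrow> k < n \<Longrightarrow> i \<noteq> k \<Longrightarrow> \<exists>j<n. E i j \<and> d i k = d j k + 1"
    and ik: "i < n" "k < n"
  shows "graph_dist G (v i) (v k) = ereal (real (d i k))"
proof -
  have v: "bij_betw v {..<n} (verts G)"
    and adj: "\<And>i j. i < n \<Longrightarrow> j < n \<Longrightarrow> v i \<rightarrow> v j \<longleftrightarrow> E i j"
    using lab by (simp_all add: labelling_def)
  define g where "g = the_inv_into {..<n} v"
  have gv: "g (v i) = i" if "i < n" for i
    unfolding g_def using v that by (auto simp: bij_betw_def the_inv_into_f_f)
  have ex: "\<exists>i<n. x = v i" if "x \<in> verts G" for x
    using v that unfolding bij_betw_def by auto
  have mem: "v i \<in> verts G" if "i < n" for i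
    using v that bij_betwE by blast
  have "graph_dist G (v i) (v k) = ereal (real (d (g (v i)) k))"
  proof (rule graph_dist_eqI)
    show "d (g (v k)) k = 0" using assms gv by simp
  next
    fix x y assume xy: "x \<rightarrow> y"
    then obtain i j where "x = v i" "y = v j" "i < n" "j < n"
      using ex adj_in_verts by metis
    then show "d (g x) k \<le> d (g y) k + 1"
      using xy adj gv assms(3) ik by simp
  next
    fix x assume "x \<in> verts G" "x \<noteq> v k"
    then obtain i where i: "x = v i" "i < n" "i \<noteq> k" using ex by blast
    then obtain j where "j < n" "E i j" "d i k = d j k + 1" using desc ik by blast
    with i show "\<exists>y. x \<rightarrow> y \<and> d (g x) k = d (g y) k + 1"
      by (intro exI[of _ "v j"]) (simp add: adj gv)
  qed (use mem ik in auto)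
  then show ?thesis using gv ik by simp
qed

lemma eqdim_le_iff_labels:
  fixes d :: "nat \<Rightarrow> nat \<Rightarrow> nat"
  assumes v: "bij_betw v {..<n} (verts G)"
    and dist: "\<And>i j. i < n \<Longrightarrow> j < n \<Longrightarrow> graph_dist G (v i) (v j) = ereal (real (d i j))"
    and "k \<le> n"
  shows "eqdim G \<le> n - k \<longleftrightarrow> (\<exists>T \<subseteq> {..<n}. card T = k \<and>
    (\<forall>x\<in>T. \<forall>y\<in>T. x \<noteq> y \<longrightarrow> (\<exists>w<n. w \<notin> T \<and> d x w = d y w)))"
proof -
  have n: "card (verts G) = n" "finite (verts G)"
    using bij_betw_same_card[OF v] bij_betw_finite[OF v] by auto
  have inj: "inj_on v {..<n}" and im: "verts G = v ` {..<n}"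
    using v by (auto simp: bij_betw_def)
  have eq: "distance_equalizer G (verts G - v ` T) \<longleftrightarrow>
    (\<forall>x\<in>T. \<forall>y\<in>T. x \<noteq> y \<longrightarrow> (\<exists>w<n. w \<notin> T \<and> d x w = d y w))" if T: "T \<subseteq> {..<n}" for T
  proof -
    have outer: "verts G - v ` T = v ` ({..<n} - T)"
      unfolding im using inj T by (simp add: inj_on_image_set_diff)
    then have inner: "verts G - v ` ({..<n} - T) = v ` T"
      using T im by (metis double_diff image_mono subset_refl)
    have "distance_equalizer G (verts G - v ` T) \<longleftrightarrow>
      (\<forall>x\<in>T. \<forall>y\<in>T. v x \<noteq> v y \<longrightarrow> (\<exists>w\<in>{..<n} - T. graph_dist G (v x) (v w) = graph_dist G (v y) (v w)))"
      unfolding distance_equalizer_def outer inner by (simp add: im image_mono)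
    also have "\<dots> \<longleftrightarrow> (\<forall>x\<in>T. \<forall>y\<in>T. x \<noteq> y \<longrightarrow> (\<exists>w\<in>{..<n} - T. d x w = d y w))"
    proof (intro ball_cong refl)
      fix x y assume "x \<in> T" "y \<in> T"
      with T have xy: "x < n" "y < n" by auto
      then have "v x = v y \<longleftrightarrow> x = y" using inj by (auto dest: inj_onD)
      with xy show "(v x \<noteq> v y \<longrightarrow> (\<exists>w\<in>{..<n} - T. graph_dist G (v x) (v w) = graph_dist G (v y) (v w)))
        \<longleftrightarrow> (x \<noteq> y \<longrightarrow> (\<exists>w\<in>{..<n} - T. d x w = d y w))"
        by (auto simp: dist)
    qed
    finally show ?thesis by (simp add: Bex_def)
  qed
  have "eqdim G \<le> n - k \<longleftrightarrow> (\<exists>T \<subseteq> verts G. card T = k \<and> distance_equalizer G (verts G - T))"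
    using eqdim_le_iff[of G k] assms(3) n by simp
  also have "\<dots> \<longleftrightarrow> (\<exists>T \<subseteq> {..<n}. card T = k \<and> distance_equalizer G (verts G - v ` T))"
  proof
    assume "\<exists>T \<subseteq> verts G. card T = k \<and> distance_equalizer G (verts G - T)"
    then show "\<exists>T \<subseteq> {..<n}. card T = k \<and> distance_equalizer G (verts G - v ` T)"
      unfolding im by (metis subset_image_iff card_image inj_on_subset[OF inj])
  next
    assume "\<exists>T \<subseteq> {..<n}. card T = k \<and> distance_equalizer G (verts G - v ` T)"
    then obtain T where "T \<subseteq> {..<n}" "card T = k" "distance_equalizer G (verts G - v ` T)"
      by blast
    then show "\<exists>T \<subseteq> verts G. card T = k \<and> distance_equalizer G (verts G - T)"
      using card_image[OF inj_on_subset[OF inj]] im by (intro exI[of _ "v ` T"]) blast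
  qed
  finally show ?thesis by (simp add: eq cong: conj_cong)
qed


section \<open>Paths and cycles\<close>

abbreviation path_adj :: "nat \<Rightarrow> nat \<Rightarrow> bool" where
  "path_adj i j \<equiv> j = i + 1 \<or> i = j + 1"

abbreviation cycle_adj :: "nat \<Rightarrow> nat \<Rightarrow> nat \<Rightarrow> bool" where
  "cycle_adj n i j \<equiv> j = (i + 1) mod n \<or> i = (j + 1) mod n"

text \<open>The absolute difference of \<open>i\<close> and \<open>j\<close>: one of the two truncated differences is \<open>0\<close>.\<close>
definition path_dist :: "nat \<Rightarrow> nat \<Rightarrow> nat" where
  "path_dist i j = (i - j) + (j - i)"

text \<open>This additive form keeps truncated subtraction out of the arithmetic.\<close>
lemma path_dist_cases:
  "i + path_dist i j = j \<or> j + path_dist i j = i"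
  by (cases "i \<le> j") (auto simp: path_dist_def)

lemma path_dist_le: "i \<le> j \<Longrightarrow> path_dist i j = j - i"
  and path_dist_ge: "j \<le> i \<Longrightarrow> path_dist i j = i - j"
  by (simp_all add: path_dist_def)

lemma path_dist_less: "i < n \<Longrightarrow> j < n \<Longrightarrow> path_dist i j < n"
  using path_dist_cases[of i j] by linarith

lemma path_dist_Suc_less: "i < k \<Longrightarrow> path_dist i k = path_dist (Suc i) k + 1"
  by (simp add: path_dist_le Suc_diff_Suc)

lemma path_dist_Suc_ge: "k \<le> i \<Longrightarrow> path_dist (Suc i) k = path_dist i k + 1"
  by (simp add: path_dist_ge Suc_diff_le)

definition cycle_dist :: "nat \<Rightarrow> nat \<Rightarrow> nat \<Rightarrow> nat" where
  "cycle_dist n i j = min (path_dist i j) (n - path_dist i j)"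

text \<open>A cycle is a path with its ends joined. This form of the adjacency is free of \<open>mod\<close> and hence
  within reach of linear arithmetic.\<close>
lemma cycle_adj_iff:
  assumes "i < n" "j < n"
  shows "cycle_adj n i j \<longleftrightarrow>
    path_adj i j \<or> i = 0 \<and> j = n - 1 \<or> j = 0 \<and> i = n - 1"
proof -
  have "(i + 1) mod n = (if i = n - 1 then 0 else i + 1)" if "i < n" for i
    using that by auto
  with assms show ?thesis by (auto split: if_splits)
qed

lemma path_labelling_graph_dist:
  assumes "wf_digraph G" "labelling G n path_adj v" "i < n" "k < n"
  shows "graph_dist G (v i) (v k) = ereal (real (path_dist i k))"
proof (rule wf_digraph.labelling_graph_dist[OF assms(1,2)])
  fix i j k assume "path_adj i j"
  then show "path_dist i k \<le> path_dist j k + 1"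
    using path_dist_cases[of i k] path_dist_cases[of j k] by (elim disjE) linarith+
next
  fix i k assume ik: "i < n" "k < n" "i \<noteq> k"
  show "\<exists>j<n. path_adj i j \<and> path_dist i k = path_dist j k + 1"
  proof (cases "i < k")
    case True
    then show ?thesis using path_dist_Suc_less[OF True] ik(2) by (intro exI[of _ "Suc i"]) auto
  next
    case False
    with ik(3) obtain m where m: "i = Suc m" "k \<le> m" by (cases i) auto
    then show ?thesis using path_dist_Suc_ge[OF m(2)] ik(1) by (intro exI[of _ m]) auto
  qed
qed (use assms in \<open>simp_all add: path_dist_def\<close>)

text \<open>The third case is a step across the edge between \<open>0\<close> and \<open>n - 1\<close>, which exchanges the two
  ways around the cycle up to one edge.\<close>
lemma path_dist_cycle_adj:
  assumes "i < n" "j < n" "k < n" "cycle_adj n i j"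
  shows "path_dist i k = path_dist j k + 1 \<or> path_dist j k = path_dist i k + 1 \<or>
    path_dist i k + path_dist j k + 1 = n"
proof -
  from assms(4) consider "j = Suc i" | "i = Suc j" | "i = 0" "j = n - 1" | "j = 0" "i = n - 1"
    unfolding cycle_adj_iff[OF assms(1,2)] by (elim disjE conjE) simp_all
  then show ?thesis
  proof cases
    case 1
    then show ?thesis
      using path_dist_Suc_less[of i k] path_dist_Suc_ge[of k i] by (cases "i < k") simp_all
  next
    case 2
    then show ?thesis
      using path_dist_Suc_less[of j k] path_dist_Suc_ge[of k j] by (cases "j < k") simp_all
  next
    case 3
    with assms(3) show ?thesis by (simp add: path_dist_le path_dist_ge)
  next
    case 4
    with assms(3) show ?thesis by (simp add: path_dist_le path_dist_ge)
  qed
qed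

lemma cycle_dist_lipschitz:
  assumes "i < n" "j < n" "k < n" "cycle_adj n i j"
  shows "cycle_dist n i k \<le> cycle_dist n j k + 1"
proof -
  let ?p = "path_dist i k" and ?q = "path_dist j k"
  have min_le: "min a b \<le> min c d + 1"
    if "a \<le> c + 1 \<or> b \<le> c + 1" "a \<le> d + 1 \<or> b \<le> d + 1" for a b c d :: nat
    using that by (simp add: min_def) linarith
  have "?p + (n - ?p) = n" "?q + (n - ?q) = n"
    using assms(1-3) path_dist_less by (simp_all add: less_imp_le)
  with path_dist_cycle_adj[OF assms] show ?thesis
    unfolding cycle_dist_def by (intro min_le) linarith+
qed

text \<open>A step from \<open>i\<close> to \<open>j\<close> shortens the direct way from \<open>i\<close> to \<open>k\<close> if it is a shortest one, and
  otherwise the way around the cycle. In the latter case the direct way either gets longer or turns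
  into the way around when the step crosses the edge between \<open>n - 1\<close> and \<open>0\<close>.\<close>
lemma cycle_dist_step_direct:
  assumes "path_dist i k = path_dist j k + 1" "2 * path_dist i k \<le> n"
  shows "cycle_dist n i k = cycle_dist n j k + 1"
  using assms by (simp add: cycle_dist_def min_absorb1)

lemma cycle_dist_step_around:
  assumes "path_dist j k = path_dist i k + 1 \<or> path_dist j k + path_dist i k + 1 = n"
    and "n < 2 * path_dist i k" "path_dist j k < n"
  shows "cycle_dist n i k = cycle_dist n j k + 1"
  using assms(1)
proof
  assume "path_dist j k = path_dist i k + 1"
  with assms(2,3) show ?thesis by (simp add: cycle_dist_def min_absorb2)
next
  assume sum: "path_dist j k + path_dist i k + 1 = n"
  then have "n - path_dist i k = path_dist j k + 1" by linarith
  with sum assms(2) show ?thesis by (simp add: cycle_dist_def min_absorb1 min_absorb2)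
qed

text \<open>The step goes towards \<open>k\<close> if the direct way is the shorter one, and away from \<open>k\<close>, around
  the cycle, otherwise.\<close>
lemma cycle_dist_descent:
  assumes "i < n" "k < n" "i \<noteq> k"
  shows "\<exists>j<n. cycle_adj n i j \<and> cycle_dist n i k = cycle_dist n j k + 1"
proof -
  let ?p = "path_dist i k"
  consider "i < k" "2 * ?p \<le> n" | "k < i" "2 * ?p \<le> n"
    | "k < i" "n < 2 * ?p" "i = n - 1" | "k < i" "n < 2 * ?p" "i \<noteq> n - 1"
    | "i < k" "n < 2 * ?p" "i = 0" | "i < k" "n < 2 * ?p" "i \<noteq> 0"
    using assms(3) by (metis linorder_neqE_nat not_le)
  then have "\<exists>j<n. (path_adj i j \<or> i = 0 \<and> j = n - 1 \<or> j = 0 \<and> i = n - 1) \<and>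
      cycle_dist n i k = cycle_dist n j k + 1"
  proof cases
    case 1
    from cycle_dist_step_direct[OF path_dist_Suc_less[OF 1(1)] 1(2)] 1(1) assms(2) show ?thesis
      by (intro exI[of _ "Suc i"]) simp
  next
    case 2
    then obtain m where m: "i = Suc m" "k \<le> m" by (cases i) auto
    from cycle_dist_step_direct[OF path_dist_Suc_ge[OF m(2)]] 2(2) m(1) assms(1) show ?thesis
      by (intro exI[of _ m]) simp
  next
    case 3
    from 3(1,3) have "path_dist 0 k + path_dist i k + 1 = n"
      by (simp add: path_dist_le path_dist_ge)
    from cycle_dist_step_around[OF disjI2[OF this] 3(2)] assms(2) 3(3) show ?thesis
      by (intro exI[of _ 0]) (simp add: path_dist_less)
  next
    case 4
    with assms(1) have "Suc i < n" by linarith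
    from cycle_dist_step_around[OF disjI1[OF path_dist_Suc_ge[OF less_imp_le[OF 4(1)]]] 4(2)]
      path_dist_less[OF this assms(2)] this show ?thesis
      by (intro exI[of _ "Suc i"]) simp
  next
    case 5
    from 5(3) assms(2) have "path_dist (n - 1) k + path_dist i k + 1 = n"
      by (simp add: path_dist_le path_dist_ge)
    from cycle_dist_step_around[OF disjI2[OF this] 5(2)] path_dist_less[of "n - 1" n k] assms(2) 5(3)
    show ?thesis by (intro exI[of _ "n - 1"]) simp
  next
    case 6
    then obtain m where m: "i = Suc m" by (cases i) auto
    then have "path_dist m k = path_dist i k + 1" using path_dist_Suc_less[of m k] 6(1) by simp
    from cycle_dist_step_around[OF disjI1[OF this] 6(2)] path_dist_less[of m n k] assms(1,2) m
    show ?thesis by (intro exI[of _ m]) simp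
  qed
  then show ?thesis using cycle_adj_iff[OF assms(1)] by blast
qed

lemma cycle_labelling_graph_dist:
  assumes "wf_digraph G" "labelling G n (cycle_adj n) v" "i < n" "k < n"
  shows "graph_dist G (v i) (v k) = ereal (real (cycle_dist n i k))"
proof (rule wf_digraph.labelling_graph_dist[OF assms(1,2)])
  show "cycle_dist n i i = 0" for i by (simp add: cycle_dist_def path_dist_def)
qed (rule assms(3,4) cycle_dist_lipschitz cycle_dist_descent; assumption)+

section \<open>Connected graphs of maximum degree two\<close>

text \<open>The vertices of a longest path have no neighbours outside the path: an inner vertex already
  has two neighbours on it, and a new neighbour of an end would prolong it. By connectedness the
  path visits every vertex. The same degree count shows that two vertices which are not consecutive
  can be adjacent only if they are the two ends.\<close>
lemma (in graph) path_or_cycle_labelling: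
  assumes "connected G"
    and deg: "\<And>x a b c. x \<rightarrow> a \<Longrightarrow> x \<rightarrow> b \<Longrightarrow> x \<rightarrow> c \<Longrightarrow> \<not> distinct [a, b, c]"
    and n: "n = card (verts G)"
  shows "(\<exists>v. labelling G n path_adj v) \<or> 3 \<le> n \<and> (\<exists>v. labelling G n (cycle_adj n) v)"
proof -
  have strong: "strongly_connected G"
    using assms(1) sym_arcs by (rule symmetric_connected_imp_strongly_connected[rotated])
  then obtain x0 where x0: "x0 \<in> verts G" unfolding strongly_connected_def by blast
  have adj_sym: "y \<rightarrow> x" if "x \<rightarrow> y" for x y
    using arcs_ends_symmetric[OF sym_arcs that] .
  define P where "P xs \<longleftrightarrow> distinct xs \<and> set xs \<subseteq> verts G \<and>
    (\<forall>i. Suc i < length xs \<longrightarrow> xs ! i \<rightarrow> xs ! Suc i)" for xs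
  have "P [x0]" using x0 by (simp add: P_def)
  moreover have "length xs \<le> n" if "P xs" for xs
    using that unfolding P_def n by (metis card_mono distinct_card finite_verts)
  then have "\<forall>xs. P xs \<longrightarrow> length xs < Suc n" by (simp add: less_Suc_eq_le)
  ultimately have "\<exists>xs. P xs \<and> (\<forall>ys. P ys \<longrightarrow> length ys \<le> length xs)"
    using ex_has_greatest_nat[of P "[x0]" length "Suc n"] by simp
  then obtain xs where xs: "P xs" and max: "\<And>ys. P ys \<Longrightarrow> length ys \<le> length xs"
    by auto
  define k where "k = length xs"
  have "1 \<le> k" using max[OF \<open>P [x0]\<close>] by (simp add: k_def)
  have dist: "distinct xs" and sub: "set xs \<subseteq> verts G"
    and step: "\<And>i. Suc i < k \<Longrightarrow> xs ! i \<rightarrow> xs ! Suc i"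
    using xs by (simp_all add: P_def k_def)
  have nth_eq: "xs ! i = xs ! j \<longleftrightarrow> i = j" if "i < k" "j < k" for i j
    using that dist by (simp add: k_def nth_eq_iff_index_eq)
  have first: "u \<in> set xs" if "xs ! 0 \<rightarrow> u" for u
  proof (rule ccontr)
    assume "u \<notin> set xs"
    then have "P (u # xs)"
      using xs adj_sym[OF that] adj_in_verts[OF that] unfolding P_def
      by (auto simp: nth_Cons split: nat.split)
    from max[OF this] show False by simp
  qed
  have last: "u \<in> set xs" if i: "Suc i = k" "xs ! i \<rightarrow> u" for i u
  proof (rule ccontr)
    assume "u \<notin> set xs"
    moreover have "(xs @ [u]) ! j \<rightarrow> (xs @ [u]) ! Suc j" if "Suc j < length (xs @ [u])" for j
    proof (cases "Suc j = k")
      case True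
      with i(1) have "j = i" by simp
      with i show ?thesis by (simp add: nth_append k_def)
    next
      case False
      with that have "Suc j < k" by (simp add: k_def)
      with step[OF this] show ?thesis by (simp add: nth_append k_def)
    qed
    ultimately have "P (xs @ [u])"
      using xs adj_in_verts[OF i(2)] unfolding P_def by simp
    from max[OF this] show False by simp
  qed
  have inner: "u = xs ! i \<or> u = xs ! Suc (Suc i)" if "Suc (Suc i) < k" "xs ! Suc i \<rightarrow> u" for i u
  proof -
    have "xs ! Suc i \<rightarrow> xs ! i" "xs ! Suc i \<rightarrow> xs ! Suc (Suc i)"
      using adj_sym[OF step[of i]] step[of "Suc i"] that(1) by simp_all
    moreover have "xs ! i \<noteq> xs ! Suc (Suc i)" using nth_eq[of i "Suc (Suc i)"] that(1) by simp
    ultimately show ?thesis using deg[OF _ _ that(2)] by auto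
  qed
  have closed: "u \<in> set xs" if "x \<in> set xs" "x \<rightarrow> u" for x u
  proof -
    obtain i where i: "i < k" "x = xs ! i"
      using \<open>x \<in> set xs\<close> unfolding in_set_conv_nth k_def by blast
    from i(1) consider "i = 0" | "Suc i = k" | "0 < i" "Suc i < k" by linarith
    then show ?thesis
    proof cases
      case 1
      with first i that show ?thesis by blast
    next
      case 2
      with last i that show ?thesis by blast
    next
      case 3
      then obtain m where m: "i = Suc m" by (cases i) simp_all
      with inner[of m u] 3(2) i(2) that(2) have "u = xs ! m \<or> u = xs ! Suc (Suc m)" by simp
      with 3(2) m show ?thesis by (auto simp: k_def)
    qed
  qed
  have "verts G \<subseteq> set xs"
  proof
    fix y assume "y \<in> verts G"
    have x: "xs ! 0 \<in> set xs" using \<open>1 \<le> k\<close> unfolding k_def by (intro nth_mem) linarith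
    then have "xs ! 0 \<rightarrow>\<^sup>* y"
      using strong sub \<open>y \<in> verts G\<close> unfolding strongly_connected_def by blast
    then show "y \<in> set xs"
      by (induction rule: reachable_induct) (use x closed in auto)
  qed
  with sub have set: "set xs = verts G" by auto
  then have k: "k = n" using dist by (metis distinct_card k_def n)
  have bij: "bij_betw ((!) xs) {..<n} (verts G)"
    using bij_betw_nth[OF dist, of "{..<n}" "verts G"] set k by (simp add: k_def)
  have order: "j = i + 1 \<or> i = 0 \<and> j = n - 1" if ij: "i < j" "j < n" "xs ! i \<rightarrow> xs ! j" for i j
  proof (cases i)
    case (Suc m)
    with ij k have less: "Suc (Suc m) < k" by linarith
    with inner[of m "xs ! j"] ij(3) Suc have "xs ! j = xs ! m \<or> xs ! j = xs ! Suc (Suc m)" by simp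
    with nth_eq[of j m] nth_eq[of j "Suc (Suc m)"] less ij(2) k have "j = m \<or> j = Suc (Suc m)"
      by simp
    with ij(1) Suc show ?thesis by simp
  next
    case 0
    with ij(1) obtain m where m: "j = Suc m" by (cases j) simp_all
    show ?thesis
    proof (cases "Suc (Suc m) < k")
      case True
      with inner[of m "xs ! i"] adj_sym[OF ij(3)] m
      have "xs ! i = xs ! m \<or> xs ! i = xs ! Suc (Suc m)" by simp
      with nth_eq[of i m] nth_eq[of i "Suc (Suc m)"] True 0 have "m = 0" by simp
      with 0 m show ?thesis by simp
    next
      case False
      with m ij(2) k have "j = n - 1" by linarith
      with 0 show ?thesis by simp
    qed
  qed
  have path: "xs ! i \<rightarrow> xs ! j" if "i < n" "j < n" "path_adj i j" for i j
    using that(3)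
  proof
    assume "j = i + 1"
    with step[of i] that(2) k show ?thesis by simp
  next
    assume "i = j + 1"
    with step[of j] that(1) k adj_sym show ?thesis by simp
  qed
  have adj: "path_adj i j \<or> i = 0 \<and> j = n - 1 \<or> j = 0 \<and> i = n - 1" and neq: "i \<noteq> j"
    if ij: "i < n" "j < n" "xs ! i \<rightarrow> xs ! j" for i j
  proof -
    show neq: "i \<noteq> j" using ij(3) adj_not_same by auto
    then consider "i < j" | "j < i" by linarith
    then show "path_adj i j \<or> i = 0 \<and> j = n - 1 \<or> j = 0 \<and> i = n - 1"
    proof cases
      case 1
      from order[OF this ij(2,3)] show ?thesis by blast
    next
      case 2
      from order[OF this ij(1) adj_sym[OF ij(3)]] show ?thesis by blast
    qed
  qed
  show ?thesis
  \<comment> \<open>On fewer than three vertices the two ends are equal or consecutive.\<close>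
  proof (cases "3 \<le> n \<and> xs ! 0 \<rightarrow> xs ! (n - 1)")
    case True
    have "xs ! i \<rightarrow> xs ! j \<longleftrightarrow> cycle_adj n i j" if "i < n" "j < n" for i j
      unfolding cycle_adj_iff[OF that]
    proof
      assume "xs ! i \<rightarrow> xs ! j"
      from adj[OF that this] show "path_adj i j \<or> i = 0 \<and> j = n - 1 \<or> j = 0 \<and> i = n - 1" .
    next
      assume "path_adj i j \<or> i = 0 \<and> j = n - 1 \<or> j = 0 \<and> i = n - 1"
      then consider "path_adj i j" | "i = 0 \<and> j = n - 1" | "j = 0 \<and> i = n - 1" by argo
      then show "xs ! i \<rightarrow> xs ! j"
      proof cases
        case 1
        from path[OF that this] show ?thesis .
      next
        case 2
        with True show ?thesis by simp
      next
        case 3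
        with True adj_sym[of "xs ! 0" "xs ! (n - 1)"] show ?thesis by simp
      qed
    qed
    with bij True show ?thesis unfolding labelling_def by blast
  next
    case False
    have "xs ! i \<rightarrow> xs ! j \<longleftrightarrow> path_adj i j" if "i < n" "j < n" for i j
    proof
      assume ij: "xs ! i \<rightarrow> xs ! j"
      show "path_adj i j"
      proof (rule ccontr)
        assume not_adj: "\<not> path_adj i j"
        with adj[OF that ij] have ends: "i = 0 \<and> j = n - 1 \<or> j = 0 \<and> i = n - 1" by blast
        with ij adj_sym have "xs ! 0 \<rightarrow> xs ! (n - 1)" by auto
        with False have "n \<le> 2" by simp
        with ends neq[OF that ij] not_adj that show False by linarith
      qed
    qed (use path that in blast)
    with bij show ?thesis unfolding labelling_def by blast
  qed
qed

section \<open>Equalizers in paths and cycles\<close>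

lemma card_3_sorted:
  fixes T :: "'a :: linorder set"
  assumes "card T = 3"
  obtains x y z where "T = {x, y, z}" "x < y" "y < z"
proof -
  obtain x y z where T: "T = {x, y, z}" "x \<noteq> y" "y \<noteq> z" "x \<noteq> z"
    using assms unfolding card_3_iff by blast
  then consider "x < y" "y < z" | "x < z" "z < y" | "y < x" "x < z"
    | "y < z" "z < x" | "z < x" "x < y" | "z < y" "y < x"
    using less_linear[of x y] less_linear[of y z] less_linear[of x z] by blast
  then show ?thesis
  proof cases
    case 1
    then show ?thesis by (rule that[rotated]) (use T(1) in blast)
  next
    case 2
    then show ?thesis by (rule that[rotated]) (use T(1) in blast)
  next
    case 3
    then show ?thesis by (rule that[rotated]) (use T(1) in blast)
  next
    case 4
    then show ?thesis by (rule that[rotated]) (use T(1) in blast)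
  next
    case 5
    then show ?thesis by (rule that[rotated]) (use T(1) in blast)
  next
    case 6
    then show ?thesis by (rule that[rotated]) (use T(1) in blast)
  qed
qed

text \<open>For a relation symmetric in the pair, three ordered pairs suffice.\<close>
lemma witnesses_of_triple:
  fixes d :: "nat \<Rightarrow> nat \<Rightarrow> 'a"
  assumes "u < n" "u \<notin> {x, y, z}" "d x u = d y u"
    and "v < n" "v \<notin> {x, y, z}" "d y v = d z v"
    and "w < n" "w \<notin> {x, y, z}" "d x w = d z w"
  shows "\<forall>a\<in>{x, y, z}. \<forall>b\<in>{x, y, z}. a \<noteq> b \<longrightarrow>
    (\<exists>c<n. c \<notin> {x, y, z} \<and> d a c = d b c)"
proof -
  let ?P = "\<lambda>a b. \<exists>c<n. c \<notin> {x, y, z} \<and> d a c = d b c"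
  have "?P x y" "?P y z" "?P x z" using assms by blast+
  moreover from this have "?P y x" "?P z y" "?P z x" by metis+
  ultimately show ?thesis by blast
qed

lemma path_dist_eq_iff:
  assumes "x \<noteq> y"
  shows "path_dist x w = path_dist y w \<longleftrightarrow> x + y = 2 * w"
proof
  assume "path_dist x w = path_dist y w"
  with assms path_dist_cases[of x w] path_dist_cases[of y w] show "x + y = 2 * w"
    by (elim disjE) linarith+
next
  assume "x + y = 2 * w"
  with path_dist_cases[of x w] path_dist_cases[of y w] show "path_dist x w = path_dist y w"
    by (elim disjE) linarith+
qed

text \<open>In other words \<open>2 * w\<close> is congruent to \<open>x + y\<close> modulo \<open>n\<close>: the equalizing vertices are
  the middles of the two arcs of the cycle between \<open>x\<close> and \<open>y\<close>, where these exist.\<close>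
lemma cycle_dist_eq_iff:
  assumes "x < n" "y < n" "w < n" "x \<noteq> y"
  shows "cycle_dist n x w = cycle_dist n y w \<longleftrightarrow>
    2 * w = x + y \<or> 2 * w = x + y + n \<or> 2 * w + n = x + y"
proof -
  let ?p = "path_dist x w" and ?q = "path_dist y w"
  have min_eq: "min a b = min c d \<longleftrightarrow> a = c \<or> a = d" if "a + b = n" "c + d = n" for a b c d
    using that by (cases "a \<le> b"; cases "c \<le> d") (simp_all only: min_absorb1 min_absorb2 nat_le_linear, linarith+)
  have "cycle_dist n x w = cycle_dist n y w \<longleftrightarrow> ?p = ?q \<or> ?p = n - ?q"
    unfolding cycle_dist_def
    using assms(1-3) path_dist_less by (intro min_eq) (simp_all add: less_imp_le)
  also have "?p = n - ?q \<longleftrightarrow> ?p + ?q = n"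
    using path_dist_less[OF assms(2,3)] by linarith
  also have "?p + ?q = n \<longleftrightarrow> 2 * w = x + y + n \<or> 2 * w + n = x + y"
  proof
    assume "?p + ?q = n"
    with assms(1-3) path_dist_cases[of x w] path_dist_cases[of y w]
    show "2 * w = x + y + n \<or> 2 * w + n = x + y"
      by (elim disjE) linarith+
  next
    assume "2 * w = x + y + n \<or> 2 * w + n = x + y"
    with assms(1-3) path_dist_cases[of x w] path_dist_cases[of y w] show "?p + ?q = n"
      by (elim disjE) linarith+
  qed
  finally show ?thesis
    by (simp only: path_dist_eq_iff[OF assms(4)] eq_commute[of "x + y"])
qed

text \<open>If \<open>2 * w\<close> is congruent to both \<open>x + y\<close> and \<open>y + z\<close> modulo \<open>n\<close>, then \<open>x\<close> and \<open>z\<close> agree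
  modulo \<open>n\<close> and are equal.\<close>
lemma cycle_dist_eq_at_most_two:
  assumes "x < n" "y < n" "z < n" "w < n" "distinct [x, y, z]"
  shows "\<not> (cycle_dist n x w = cycle_dist n y w \<and> cycle_dist n y w = cycle_dist n z w)"
proof
  assume eq: "cycle_dist n x w = cycle_dist n y w \<and> cycle_dist n y w = cycle_dist n z w"
  from assms have neq: "x \<noteq> y" "y \<noteq> z" "x \<noteq> z" by auto
  have xy: "2 * w = x + y \<or> 2 * w = x + y + n \<or> 2 * w + n = x + y"
    using cycle_dist_eq_iff[OF assms(1,2,4) neq(1)] eq by blast
  have yz: "2 * w = y + z \<or> 2 * w = y + z + n \<or> 2 * w + n = y + z"
    using cycle_dist_eq_iff[OF assms(2,3,4) neq(2)] eq by blast
  have "x = z"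
    using xy yz assms(1,3) by (elim disjE) linarith+
  with neq show False by simp
qed

text \<open>Let \<open>x < y < z\<close> be left out. The midpoints of neighbouring pairs force gaps of at least \<open>2\<close>;
  the midpoint \<open>c\<close> of \<open>x\<close> and \<open>z\<close> must differ from \<open>y\<close>, which makes the gaps different even
  numbers, so that \<open>z - x\<close> is at least \<open>6\<close>.\<close>
lemma path_eqdim_le_minus_3_iff:
  assumes wf: "wf_digraph G" and lab: "labelling G n path_adj v" and n: "3 \<le> n"
  shows "eqdim G \<le> n - 3 \<longleftrightarrow> 7 \<le> n"
proof -
  have iff: "eqdim G \<le> n - 3 \<longleftrightarrow> (\<exists>T \<subseteq> {..<n}. card T = 3 \<and>
    (\<forall>x\<in>T. \<forall>y\<in>T. x \<noteq> y \<longrightarrow> (\<exists>w<n. w \<notin> T \<and> path_dist x w = path_dist y w)))"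
    by (rule eqdim_le_iff_labels)
      (use path_labelling_graph_dist[OF wf lab] lab n in \<open>auto simp: labelling_def\<close>)
  show ?thesis
  proof
    assume "7 \<le> n"
    have "path_dist 0 1 = path_dist 2 1" "path_dist 2 4 = path_dist 6 4"
      "path_dist 0 3 = path_dist 6 3"
      by (simp_all add: path_dist_eq_iff)
    then have "\<forall>x\<in>{0, 2, 6}. \<forall>y\<in>{0, 2, 6}. x \<noteq> y \<longrightarrow>
        (\<exists>w<n. w \<notin> {0, 2, 6} \<and> path_dist x w = path_dist y w)"
      using \<open>7 \<le> n\<close> by (intro witnesses_of_triple[where u = 1 and v = 4 and w = 3]) simp_all
    with \<open>7 \<le> n\<close> show "eqdim G \<le> n - 3"
      unfolding iff by (intro exI[of _ "{0, 2, 6}"]) simp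
  next
    assume "eqdim G \<le> n - 3"
    then obtain T where T: "T \<subseteq> {..<n}" "card T = 3"
      and eq: "\<And>x y. x \<in> T \<Longrightarrow> y \<in> T \<Longrightarrow> x \<noteq> y \<Longrightarrow> \<exists>w. w \<notin> T \<and> x + y = 2 * w"
      unfolding iff using path_dist_eq_iff by metis
    from T(2) obtain x y z where xyz: "T = {x, y, z}" "x < y" "y < z"
      by (rule card_3_sorted)
    then obtain a b c where abc: "x + y = 2 * a" "y + z = 2 * b" "x + z = 2 * c" "c \<noteq> y"
      using eq[of x y] eq[of y z] eq[of x z] by auto
    have between: "x < a" "a < y" "y < b" "b < z" using abc(1,2) xyz(2,3) by linarith+
    from \<open>c \<noteq> y\<close> consider "c < y" | "y < c" by linarith
    then have "6 \<le> z" by cases (use abc(1,2,3) between in linarith)+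
    with T(1) xyz(1) show "7 \<le> n" by simp
  qed
qed

text \<open>If \<open>n < 6\<close>, at most two vertices remain besides the three left out, so one vertex has to
  equalize two of the three pairs and is equidistant from all three, which is impossible in a
  cycle.\<close>
lemma cycle_eqdim_le_minus_3_iff:
  assumes wf: "wf_digraph G" and lab: "labelling G n (cycle_adj n) v" and n: "3 \<le> n"
  shows "eqdim G \<le> n - 3 \<longleftrightarrow> 6 \<le> n"
proof -
  have iff: "eqdim G \<le> n - 3 \<longleftrightarrow> (\<exists>T \<subseteq> {..<n}. card T = 3 \<and>
    (\<forall>x\<in>T. \<forall>y\<in>T. x \<noteq> y \<longrightarrow> (\<exists>w<n. w \<notin> T \<and> cycle_dist n x w = cycle_dist n y w)))"
    by (rule eqdim_le_iff_labels)
      (use cycle_labelling_graph_dist[OF wf lab] lab n in \<open>auto simp: labelling_def\<close>)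
  show ?thesis
  proof
    assume "6 \<le> n"
    show "eqdim G \<le> n - 3"
    proof (cases "n = 6")
      case True
      \<comment> \<open>The midpoint \<open>2\<close> of \<open>0\<close> and \<open>4\<close> is left out itself; its antipode \<open>5\<close> takes its place.\<close>
      have "cycle_dist n 0 1 = cycle_dist n 2 1" "cycle_dist n 2 3 = cycle_dist n 4 3"
        "cycle_dist n 0 5 = cycle_dist n 4 5"
        unfolding True by (simp_all only: cycle_dist_def path_dist_def) simp_all
      then have "\<forall>x\<in>{0, 2, 4}. \<forall>y\<in>{0, 2, 4}. x \<noteq> y \<longrightarrow>
          (\<exists>w<n. w \<notin> {0, 2, 4} \<and> cycle_dist n x w = cycle_dist n y w)"
        unfolding True by (intro witnesses_of_triple[where u = 1 and v = 3 and w = 5]) simp_all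
      with True show ?thesis
        unfolding iff by (intro exI[of _ "{0, 2, 4}"]) simp
    next
      case False
      with \<open>6 \<le> n\<close> have "7 \<le> n" by simp
      then have "cycle_dist n 0 1 = cycle_dist n 2 1" "cycle_dist n 2 4 = cycle_dist n 6 4"
        "cycle_dist n 0 3 = cycle_dist n 6 3"
        by (simp_all add: cycle_dist_eq_iff)
      then have "\<forall>x\<in>{0, 2, 6}. \<forall>y\<in>{0, 2, 6}. x \<noteq> y \<longrightarrow>
          (\<exists>w<n. w \<notin> {0, 2, 6} \<and> cycle_dist n x w = cycle_dist n y w)"
        using \<open>7 \<le> n\<close> by (intro witnesses_of_triple[where u = 1 and v = 4 and w = 3]) simp_all
      with \<open>7 \<le> n\<close> show ?thesis
        unfolding iff by (intro exI[of _ "{0, 2, 6}"]) simp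
    qed
  next
    assume "eqdim G \<le> n - 3"
    then obtain T where T: "T \<subseteq> {..<n}" "card T = 3"
      and eq: "\<forall>x\<in>T. \<forall>y\<in>T. x \<noteq> y \<longrightarrow>
        (\<exists>w<n. w \<notin> T \<and> cycle_dist n x w = cycle_dist n y w)"
      unfolding iff by blast
    show "6 \<le> n"
    proof (rule ccontr)
      assume "\<not> 6 \<le> n"
      from T(2) obtain x y z where xyz: "T = {x, y, z}" "x < y" "y < z"
        by (rule card_3_sorted)
      with T(1) have less: "x < n" "y < n" "z < n" by auto
      obtain a b c where abc: "{a, b, c} \<subseteq> {..<n} - T"
        and a: "cycle_dist n x a = cycle_dist n y a"
        and b: "cycle_dist n y b = cycle_dist n z b"
        and c: "cycle_dist n x c = cycle_dist n z c"
        using eq xyz by auto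
      have "card ({..<n} - T) \<le> 2"
        using T \<open>\<not> 6 \<le> n\<close> finite_subset[OF T(1)] by (simp add: card_Diff_subset)
      with card_mono[OF _ abc] have "card {a, b, c} \<le> 2" by simp
      then have "a = b \<or> b = c \<or> a = c" by (auto simp: card_insert_if split: if_splits)
      then obtain w where "w < n" "cycle_dist n x w = cycle_dist n y w" "cycle_dist n y w = cycle_dist n z w"
        using a b c abc by (elim disjE) auto
      then show False
        using cycle_dist_eq_at_most_two[of x n y z w] less xyz by simp
    qed
  qed
qed

section \<open>Graphs of large equidistant dimension\<close>

lemma (in graph) eqdim_le_minus_3_or_path_or_cycle:
  assumes "connected G" "card (verts G) = n"
  shows "3 \<le> n \<and> eqdim G \<le> n - 3 \<or> (\<exists>v. labelling G n path_adj v) \<or>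
    3 \<le> n \<and> (\<exists>v. labelling G n (cycle_adj n) v)"
proof (cases "\<exists>x a b c. x \<rightarrow> a \<and> x \<rightarrow> b \<and> x \<rightarrow> c \<and> distinct [a, b, c]")
  case True
  then obtain x a b c where x: "a \<rightarrow> x" "b \<rightarrow> x" "c \<rightarrow> x" and abc: "distinct [a, b, c]"
    using arcs_ends_symmetric[OF sym_arcs] by metis
  then have "{a, b, c} \<subseteq> verts G" using adj_in_verts by auto
  from card_mono[OF finite_verts this] abc assms(2) have "3 \<le> n" by auto
  moreover have "eqdim G \<le> card (verts G) - card {a, b, c}"
    using x by (intro eqdim_le_if_neighbours[of _ x]) auto
  moreover have "card {a, b, c} = 3" using abc by simp
  ultimately show ?thesis unfolding assms(2) by simp
next
  case False
  then show ?thesis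
    using path_or_cycle_labelling[OF assms(1), of n] assms(2) by blast
qed

lemma (in graph) eqdim_le_minus_2:
  assumes "connected G" "card (verts G) = n" "3 \<le> n"
  shows "eqdim G \<le> n - 2"
proof -
  have labelled: "eqdim G \<le> n - 2" if "labelling G n E v" "E 0 1" "E 2 1" for E v
  proof -
    have "v 0 \<rightarrow> v 1" "v 2 \<rightarrow> v 1" and inj: "inj_on v {..<n}"
      using that assms(3) by (auto simp: labelling_def bij_betw_def)
    then have "eqdim G \<le> card (verts G) - card {v 0, v 2}"
      by (intro eqdim_le_if_neighbours[of _ "v 1"]) auto
    moreover have "v 0 \<noteq> v 2"
      using inj_on_eq_iff[OF inj, of 0 2] assms(3) by simp
    ultimately show ?thesis using assms(2) by simp
  qed
  show ?thesis
    using eqdim_le_minus_3_or_path_or_cycle[OF assms(1,2)]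
  proof (elim disjE conjE exE)
    assume "eqdim G \<le> n - 3"
    then show ?thesis by linarith
  qed (use labelled assms(3) in auto)
qed

lemma (in fin_digraph) eqdim_le_minus_1:
  assumes "verts G \<noteq> {}"
  shows "eqdim G \<le> card (verts G) - 1"
proof -
  obtain x where "x \<in> verts G" using assms by blast
  then have "\<exists>T\<subseteq>verts G. card T = 1 \<and> distance_equalizer G (verts G - T)"
    by (intro exI[of _ "{x}"]) (auto simp: distance_equalizer_def)
  moreover have "1 \<le> card (verts G)" using assms by (simp add: Suc_le_eq card_gt_0_iff)
  ultimately show ?thesis using eqdim_le_iff[OF finite_verts] by blast
qed

text \<open>The empty set equalizes nothing, so it cannot have two vertices outside.\<close>
lemma (in fin_digraph) eqdim_of_order_2:
  assumes "card (verts G) = 2"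
  shows "eqdim G = 1"
proof -
  have "\<not> distance_equalizer G {}"
  proof
    assume "distance_equalizer G {}"
    then have "x = y" if "x \<in> verts G" "y \<in> verts G" for x y
      using that unfolding distance_equalizer_def by blast
    then have "card (verts G) \<le> 1" by (auto simp: card_le_Suc0_iff_eq)
    then show False using assms by simp
  qed
  moreover have "verts G - T = {}" if "T \<subseteq> verts G" "card T = 2" for T
    using card_subset_eq[OF finite_verts that(1)] that(2) assms by simp
  ultimately have "\<not> eqdim G \<le> card (verts G) - 2"
    using eqdim_le_iff[OF finite_verts, of 2] assms by (metis order_refl)
  moreover have "eqdim G \<le> card (verts G) - 1"
    by (rule eqdim_le_minus_1) (use assms in auto)
  ultimately show ?thesis using assms by linarith
qed

lemma labelling_order:
  assumes "labelling G k E v"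
  shows "k = card (verts G)"
  using assms bij_betw_same_card[of v "{..<k}" "verts G"] by (simp add: labelling_def)

lemma (in nomulti_digraph) digraph_iso_path_graph_iff:
  "digraph_iso G (path_graph k) \<longleftrightarrow> (\<exists>v. labelling G k path_adj v)"
  unfolding path_graph_def by (rule digraph_iso_labelled_iff)

lemma (in nomulti_digraph) digraph_iso_cycle_graph_iff:
  "digraph_iso G (cycle_graph k) \<longleftrightarrow> (\<exists>v. labelling G k (cycle_adj k) v)"
  unfolding cycle_graph_def by (rule digraph_iso_labelled_iff)

lemma (in graph) eqdim_eq_order_minus_1_iff:
  assumes "connected G" "card (verts G) = n" "2 \<le> n"
  shows "eqdim G = n - 1 \<longleftrightarrow> digraph_iso G (path_graph 2)"
proof (cases "n = 2")
  case True
  then have "\<exists>v. labelling G 2 path_adj v"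
    using eqdim_le_minus_3_or_path_or_cycle[OF assms(1,2)] by simp
  moreover have "eqdim G = n - 1" using eqdim_of_order_2 True assms(2) by simp
  ultimately show ?thesis by (simp add: digraph_iso_path_graph_iff)
next
  case False
  then have "\<not> digraph_iso G (path_graph 2)"
    unfolding digraph_iso_path_graph_iff using assms(2) by (auto dest: labelling_order)
  moreover have "eqdim G \<le> n - 2"
    using eqdim_le_minus_2 assms False by simp
  ultimately show ?thesis using False assms(3) by linarith
qed

lemma (in graph) eqdim_eq_order_minus_2_iff:
  assumes "connected G" "card (verts G) = n" "3 \<le> n"
  shows "eqdim G = n - 2 \<longleftrightarrow>
    (\<exists>k \<in> {3, 4, 5, 6}. digraph_iso G (path_graph k)) \<or>
    (\<exists>k \<in> {3, 4, 5}. digraph_iso G (cycle_graph k))" (is "_ \<longleftrightarrow> ?R")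
proof -
  have "eqdim G = n - 2 \<longleftrightarrow> \<not> eqdim G \<le> n - 3"
    using eqdim_le_minus_2[OF assms] assms(3) by linarith
  also have "\<dots> \<longleftrightarrow> ?R"
  proof
    assume gt: "\<not> eqdim G \<le> n - 3"
    then have "(\<exists>v. labelling G n path_adj v) \<or> (\<exists>v. labelling G n (cycle_adj n) v)"
      using eqdim_le_minus_3_or_path_or_cycle[OF assms(1,2)] by blast
    then show ?R
    proof (elim disjE exE)
      fix v assume v: "labelling G n path_adj v"
      with gt path_eqdim_le_minus_3_iff[OF wf_digraph v assms(3)] have "\<not> 7 \<le> n" by blast
      with assms(3) have "n = 3 \<or> n = 4 \<or> n = 5 \<or> n = 6" by presburger
      with v digraph_iso_path_graph_iff show ?R by blast
    next
      fix v assume v: "labelling G n (cycle_adj n) v"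
      with gt cycle_eqdim_le_minus_3_iff[OF wf_digraph v assms(3)] have "\<not> 6 \<le> n" by blast
      with assms(3) have "n = 3 \<or> n = 4 \<or> n = 5" by presburger
      with v digraph_iso_cycle_graph_iff show ?R by blast
    qed
  next
    assume ?R
    then show "\<not> eqdim G \<le> n - 3"
    proof (elim disjE bexE)
      fix k :: nat assume k: "k \<in> {3, 4, 5, 6}" "digraph_iso G (path_graph k)"
      then obtain v where v: "labelling G k path_adj v"
        using digraph_iso_path_graph_iff by blast
      have "k = n" using labelling_order[OF v] assms(2) by simp
      with k(1) path_eqdim_le_minus_3_iff[OF wf_digraph v] show ?thesis by auto
    next
      fix k :: nat assume k: "k \<in> {3, 4, 5}" "digraph_iso G (cycle_graph k)"
      then obtain v where v: "labelling G k (cycle_adj k) v"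
        using digraph_iso_cycle_graph_iff by blast
      have "k = n" using labelling_order[OF v] assms(2) by simp
      with k(1) cycle_eqdim_le_minus_3_iff[OF wf_digraph v] show ?thesis by auto
    qed
  qed
  finally show ?thesis .
qed

theorem theorem5:
  fixes G :: "('a, 'b) pre_digraph" and n :: nat
  assumes "graph G"
    and "connected G"
    and "card (verts G) = n"
  shows "(2 \<le> n \<longrightarrow> (eqdim G = n - 1 \<longleftrightarrow> digraph_iso G (path_graph 2))) \<and>
         (3 \<le> n \<longrightarrow> (eqdim G = n - 2 \<longleftrightarrow>
            (\<exists>k \<in> {3, 4, 5, 6}. digraph_iso G (path_graph k)) \<or>
            (\<exists>k \<in> {3, 4, 5}. digraph_iso G (cycle_graph k))))"
  using graph.eqdim_eq_order_minus_1_iff[OF assms] graph.eqdim_eq_order_minus_2_iff[OF assms]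
  by blast

end
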